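(* The formulas $\mathrm{POR}$ and $|\gimel_2|\le 4$ are universally equivalent, i.e. the formula $\mathrm{POR}\leftrightarrow(|\gimel_2|\le 4)$ is realized by a proof-like term with respect to every pole.
   Context: $\lambda_c$-calculus. Fix a countably infinite set of variables. $\lambda_c$-terms are given by $t,u ::= x \mid tu \mid \lambda x.t \mid \mathrm{cc} \mid k_\pi$ ($\pi$ a stack) $\mid \kappa_m$ ($m\in\mathbb{N}$, non-restricted instructions) $\mid \beta_m$ ($m\in\mathbb{N}$, restricted instructions), modulo $\alpha$-equivalence. A term is a closed $\lambda_c$-term; $\Lambda$ is the set of terms. Stacks: $\pi ::= \omega_m$ ($m\in\mathbb{N}$) $\mid t\cdot\pi$ ($t\in\Lambda$); $\Pi$ is the set of stacks. Processes are pairs $t\star\pi$. One-step evaluation $\succ_1$ is the smallest relation on processes with $tu\star\pi \succ_1 t\star u\cdot\pi$, $\lambda x.t\star u\cdot\pi\succ_1 t[x:=u]\star\pi$, $\mathrm{cc}\star t\cdot\pi\succ_1 t\star k_\pi\cdot\pi$, $k_{\pi'}\star t\cdot\pi\succ_1 t\star\pi'$; $\succ$ is its reflexive-transitive closure. A pole is a set $\perp\!\!\!\perp$ of processes such that $p\succ q$ and $q\in\perp\!\!\!\perp$ imply $p\in\perp\!\!\!\perp$. A term is proof-like if it contains no $k_\pi$ and no restricted instruction. Formulas. First-order terms: $a ::= x \mid f(a_1,\dots,a_k)$ for any $f:\mathbb{N}^k\to\mathbb{N}$. Formulas: $A,B ::= X(a_1,\dots,a_k)$ ($X$ a $k$-ary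 second-order variable, $k\ge0$) $\mid \top\mid\bot\mid A\to B\mid \forall x\,A\mid\forall X\,A\mid (a=b)\hookrightarrow A\mid A\cap B\mid A\cup B\mid F(a_1,\dots,a_k)$ ($F:\mathbb{N}^k\to\mathcal{P}(\Pi)$). For a pole $\perp\!\!\!\perp$ and closed $A$: $\|\top\|=\emptyset$, $\|\bot\|=\Pi$, $\|A\to B\|=\{t\cdot\pi: t\in|A|,\pi\in\|B\|\}$, $\|\forall x A\|=\bigcup_{m}\|A[x:=m]\|$, $\|\forall X A\|=\bigcup_{F:\mathbb{N}^k\to\mathcal{P}(\Pi)}\|A[X:=F]\|$, $\|(a=b)\hookrightarrow A\|=\|A\|$ if $a,b$ have equal values else $\emptyset$, $\|A\cap B\|=\|A\|\cup\|B\|$, $\|A\cup B\|=\|A\|\cap\|B\|$, $\|F(\vec a)\|=F(\text{values})$; $|A|=\{t:\forall\pi\in\|A\|,\ t\star\pi\in\perp\!\!\!\perp\}$; $t$ realizes $A$ w.r.t. $\perp\!\!\!\perp$ if $t\in|A|$. Abbreviations: $a=b$ is $\forall Z(Z(a)\to Z(b))$; $a\neq b$ is $(a=b)\hookrightarrow\bot$; $A\wedge B$ is $\forall Z((A\to B\to Z)\to Z)$, $A\vee B$ is $\forall Z((A\to Z)\to(B\to Z)\to Z)$, $A\leftrightarrow B$ is $(A\to B)\wedge(B\to A)$. Two closed formulas $A,B$ are universally equivalent if $A\leftrightarrow B$ is realized by some proof-like term w.r.t. every pole. $\mathrm{Bool}(y)$ denotes $\forall X\,(X(0)\to X(1)\to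 X(y))$ ($X$ unary). $\mathrm{POR}$ denotes $(\mathrm{Bool}(1)\to\top\to\mathrm{Bool}(1))\cap(\top\to\mathrm{Bool}(1)\to\mathrm{Bool}(1))\cap(\mathrm{Bool}(0)\to\mathrm{Bool}(0)\to\mathrm{Bool}(0))$. $\gimel_2$. On $\mathbb{N}$: $m\vee n=1$ if $m>0$ or $n>0$, else $0$; $m\wedge n=1$ if both $>0$, else $0$; $\neg m=1$ if $m=0$, else $0$. $\gimel_2(a)$ is the formula $\min(a+1,2)=a+1$. For a formula $A$ built from variables, $0,1,\vee,\wedge,\neg$ (on terms) and $\top,\bot,=,\neq,\to,\vee,\wedge,\forall x$, $\gimel_2\models A$ is $A$ with every $\forall x\,B$ replaced by $\forall x(\gimel_2(x)\hookrightarrow B)$. $|\gimel_2|\le 4$ denotes $\gimel_2\models\forall x_1\dots x_5\ \bigvee_{i\neq j}(x_i=x_j)$. *)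

theory Defs
  imports Main
begin

section \<open>The \<open>\<lambda>\<^sub>c\<close>-calculus\<close>

text \<open>
  Terms modulo \<open>\<alpha>\<close>-equivalence are represented with de Bruijn indices. The datatypes contain raw
  stacks built from open terms; these are excluded by \<open>wf_trm\<close> and \<open>wf_stack\<close>.
\<close>

datatype trm =
    Var nat
  | App trm trm
  | Lam trm
  | CC
  | Cont stack
  | Kappa nat   \<comment> \<open>non-restricted instructions\<close>
  | Beta nat    \<comment> \<open>restricted instructions\<close>
and stack =
    Omega nat
  | Push trm stack  (infixr "\<cdot>" 65)

text \<open>\<open>wf_trm n t\<close>: all free indices of \<open>t\<close> are below \<open>n\<close>, and the stacks occurring in \<open>t\<close> are built
  from closed terms.\<close>

fun wf_trm :: "nat \<Rightarrow> trm \<Rightarrow> bool" and wf_stack :: "stack \<Rightarrow> bool" where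
  "wf_trm n (Var i) = (i < n)"
| "wf_trm n (App t u) = (wf_trm n t \<and> wf_trm n u)"
| "wf_trm n (Lam t) = wf_trm (Suc n) t"
| "wf_trm n CC = True"
| "wf_trm n (Cont \<pi>) = wf_stack \<pi>"
| "wf_trm n (Kappa m) = True"
| "wf_trm n (Beta m) = True"
| "wf_stack (Omega m) = True"
| "wf_stack (t \<cdot> \<pi>) = (wf_trm 0 t \<and> wf_stack \<pi>)"

definition terms :: "trm set" where
  "terms = {t. wf_trm 0 t}"

definition stacks :: "stack set" where
  "stacks = {\<pi>. wf_stack \<pi>}"

type_synonym process = "trm \<times> stack"

definition processes :: "process set" where
  "processes = terms \<times> stacks"

text \<open>Substitution of a closed term \<open>u\<close> for the index \<open>k\<close>. As \<open>u\<close> is closed it is not lifted under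
  binders, and as stacks are closed nothing is substituted in them.\<close>

primrec subst_trm :: "trm \<Rightarrow> nat \<Rightarrow> trm \<Rightarrow> trm" where
  "subst_trm (Var i) k u = (if i = k then u else if k < i then Var (i - 1) else Var i)"
| "subst_trm (App t s) k u = App (subst_trm t k u) (subst_trm s k u)"
| "subst_trm (Lam t) k u = Lam (subst_trm t (Suc k) u)"
| "subst_trm CC k u = CC"
| "subst_trm (Cont \<pi>) k u = Cont \<pi>"
| "subst_trm (Kappa m) k u = Kappa m"
| "subst_trm (Beta m) k u = Beta m"

inductive eval1 :: "process \<Rightarrow> process \<Rightarrow> bool"  (infix "\<succ>\<^sub>1" 50) where
  push: "(App t u, \<pi>) \<in> processes \<Longrightarrow> (App t u, \<pi>) \<succ>\<^sub>1 (t, u \<cdot> \<pi>)"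
| grab: "(Lam t, u \<cdot> \<pi>) \<in> processes \<Longrightarrow> (Lam t, u \<cdot> \<pi>) \<succ>\<^sub>1 (subst_trm t 0 u, \<pi>)"
| save: "(CC, t \<cdot> \<pi>) \<in> processes \<Longrightarrow> (CC, t \<cdot> \<pi>) \<succ>\<^sub>1 (t, Cont \<pi> \<cdot> \<pi>)"
| restore: "(Cont \<pi>', t \<cdot> \<pi>) \<in> processes \<Longrightarrow> (Cont \<pi>', t \<cdot> \<pi>) \<succ>\<^sub>1 (t, \<pi>')"

abbreviation eval :: "process \<Rightarrow> process \<Rightarrow> bool"  (infix "\<succ>" 50) where
  "p \<succ> q \<equiv> eval1\<^sup>*\<^sup>* p q"

definition pole :: "process set \<Rightarrow> bool" where
  "pole P \<longleftrightarrow> P \<subseteq> processes \<and> (\<forall>p q. p \<succ> q \<longrightarrow> q \<in> P \<longrightarrow> p \<in> P)"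

primrec no_cont_no_beta :: "trm \<Rightarrow> bool" where
  "no_cont_no_beta (Var i) = True"
| "no_cont_no_beta (App t u) = (no_cont_no_beta t \<and> no_cont_no_beta u)"
| "no_cont_no_beta (Lam t) = no_cont_no_beta t"
| "no_cont_no_beta CC = True"
| "no_cont_no_beta (Cont \<pi>) = False"
| "no_cont_no_beta (Kappa m) = True"
| "no_cont_no_beta (Beta m) = False"

definition proof_like :: "trm \<Rightarrow> bool" where
  "proof_like t \<longleftrightarrow> t \<in> terms \<and> no_cont_no_beta t"


section \<open>Formulas\<close>

text \<open>
  Functions on \<open>\<nat>\<^sup>k\<close> are represented by functions on lists, of which only the values on lists of
  length \<open>k\<close> matter; the arity \<open>k\<close> of a symbol is the number of arguments it is applied to.
\<close>

datatype fo_term =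
    FVar nat
  | Fn "nat list \<Rightarrow> nat" "fo_term list"

type_synonym pred = "nat list \<Rightarrow> stack set"

text \<open>
  A second-order variable is a pair of an arity and a name: \<open>PVar X as\<close> is an occurrence of the
  variable \<open>(length as, X)\<close>, and \<open>AllP k X A\<close> binds the variable \<open>(k, X)\<close>.
\<close>

datatype formula =
    PVar nat "fo_term list"
  | Top
  | Bot
  | Imp formula formula  (infixr "\<rightarrow>\<^sub>f" 55)
  | AllN nat formula
  | AllP nat nat formula
  | EqImp fo_term fo_term formula  \<comment> \<open>\<open>(a = b) \<hookrightarrow> A\<close>\<close>
  | Inter formula formula  (infixr "\<inter>\<^sub>f" 60)
  | Union formula formula  (infixr "\<union>\<^sub>f" 58)
  | Param pred "fo_term list"

definition Num :: "nat \<Rightarrow> fo_term" where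
  "Num m = Fn (\<lambda>_. m) []"

primrec subst_fo :: "nat \<Rightarrow> nat \<Rightarrow> fo_term \<Rightarrow> fo_term" where
  "subst_fo x m (FVar y) = (if y = x then Num m else FVar y)"
| "subst_fo x m (Fn f as) = Fn f (map (subst_fo x m) as)"

primrec substN :: "nat \<Rightarrow> nat \<Rightarrow> formula \<Rightarrow> formula" where
  "substN x m (PVar X as) = PVar X (map (subst_fo x m) as)"
| "substN x m Top = Top"
| "substN x m Bot = Bot"
| "substN x m (A \<rightarrow>\<^sub>f B) = (substN x m A \<rightarrow>\<^sub>f substN x m B)"
| "substN x m (AllN y A) = AllN y (if y = x then A else substN x m A)"
| "substN x m (AllP k X A) = AllP k X (substN x m A)"
| "substN x m (EqImp a b A) = EqImp (subst_fo x m a) (subst_fo x m b) (substN x m A)"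
| "substN x m (A \<inter>\<^sub>f B) = (substN x m A \<inter>\<^sub>f substN x m B)"
| "substN x m (A \<union>\<^sub>f B) = (substN x m A \<union>\<^sub>f substN x m B)"
| "substN x m (Param F as) = Param F (map (subst_fo x m) as)"

primrec substP :: "nat \<Rightarrow> nat \<Rightarrow> pred \<Rightarrow> formula \<Rightarrow> formula" where
  "substP k X F (PVar Y as) = (if Y = X \<and> length as = k then Param F as else PVar Y as)"
| "substP k X F Top = Top"
| "substP k X F Bot = Bot"
| "substP k X F (A \<rightarrow>\<^sub>f B) = (substP k X F A \<rightarrow>\<^sub>f substP k X F B)"
| "substP k X F (AllN y A) = AllN y (substP k X F A)"
| "substP k X F (AllP l Y A) = AllP l Y (if l = k \<and> Y = X then A else substP k X F A)"
| "substP k X F (EqImp a b A) = EqImp a b (substP k X F A)"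
| "substP k X F (A \<inter>\<^sub>f B) = (substP k X F A \<inter>\<^sub>f substP k X F B)"
| "substP k X F (A \<union>\<^sub>f B) = (substP k X F A \<union>\<^sub>f substP k X F B)"
| "substP k X F (Param G as) = Param G as"

primrec fv_fo :: "fo_term \<Rightarrow> nat set" where
  "fv_fo (FVar x) = {x}"
| "fv_fo (Fn f as) = \<Union>(set (map fv_fo as))"

primrec fvN :: "formula \<Rightarrow> nat set" where
  "fvN (PVar X as) = (\<Union>a\<in>set as. fv_fo a)"
| "fvN Top = {}"
| "fvN Bot = {}"
| "fvN (A \<rightarrow>\<^sub>f B) = fvN A \<union> fvN B"
| "fvN (AllN x A) = fvN A - {x}"
| "fvN (AllP k X A) = fvN A"
| "fvN (EqImp a b A) = fv_fo a \<union> fv_fo b \<union> fvN A"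
| "fvN (A \<inter>\<^sub>f B) = fvN A \<union> fvN B"
| "fvN (A \<union>\<^sub>f B) = fvN A \<union> fvN B"
| "fvN (Param F as) = (\<Union>a\<in>set as. fv_fo a)"

primrec fvP :: "formula \<Rightarrow> (nat \<times> nat) set" where
  "fvP (PVar X as) = {(length as, X)}"
| "fvP Top = {}"
| "fvP Bot = {}"
| "fvP (A \<rightarrow>\<^sub>f B) = fvP A \<union> fvP B"
| "fvP (AllN x A) = fvP A"
| "fvP (AllP k X A) = fvP A - {(k, X)}"
| "fvP (EqImp a b A) = fvP A"
| "fvP (A \<inter>\<^sub>f B) = fvP A \<union> fvP B"
| "fvP (A \<union>\<^sub>f B) = fvP A \<union> fvP B"
| "fvP (Param F as) = {}"

text \<open>The functions \<open>\<nat>\<^sup>k \<rightarrow> \<P>(\<Pi>)\<close>.\<close>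

definition preds :: "nat \<Rightarrow> pred set" where
  "preds k = {F. \<forall>v. length v = k \<longrightarrow> F v \<subseteq> stacks}"

primrec wf_params :: "formula \<Rightarrow> bool" where
  "wf_params (PVar X as) = True"
| "wf_params Top = True"
| "wf_params Bot = True"
| "wf_params (A \<rightarrow>\<^sub>f B) = (wf_params A \<and> wf_params B)"
| "wf_params (AllN x A) = wf_params A"
| "wf_params (AllP k X A) = wf_params A"
| "wf_params (EqImp a b A) = wf_params A"
| "wf_params (A \<inter>\<^sub>f B) = (wf_params A \<and> wf_params B)"
| "wf_params (A \<union>\<^sub>f B) = (wf_params A \<and> wf_params B)"
| "wf_params (Param F as) = (F \<in> preds (length as))"

definition closed_formula :: "formula \<Rightarrow> bool" where
  "closed_formula A \<longleftrightarrow> wf_params A \<and> fvN A = {} \<and> fvP A = {}"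


section \<open>Realizability\<close>

text \<open>The values given to variables in \<open>val\<close> and \<open>falsity\<close> are irrelevant: both functions are
  meant for closed arguments only.\<close>

primrec val :: "fo_term \<Rightarrow> nat" where
  "val (FVar x) = 0"
| "val (Fn f as) = f (map val as)"

definition orth :: "process set \<Rightarrow> stack set \<Rightarrow> trm set" where
  "orth P S = {t \<in> terms. \<forall>\<pi>\<in>S. (t, \<pi>) \<in> P}"

primrec depth :: "formula \<Rightarrow> nat" where
  "depth (PVar X as) = 0"
| "depth Top = 0"
| "depth Bot = 0"
| "depth (A \<rightarrow>\<^sub>f B) = Suc (max (depth A) (depth B))"
| "depth (AllN x A) = Suc (depth A)"
| "depth (AllP k X A) = Suc (depth A)"
| "depth (EqImp a b A) = Suc (depth A)"
| "depth (A \<inter>\<^sub>f B) = Suc (max (depth A) (depth B))"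
| "depth (A \<union>\<^sub>f B) = Suc (max (depth A) (depth B))"
| "depth (Param F as) = 0"

lemma depth_substN [simp]: "depth (substN x m A) = depth A"
  by (induction A) auto

lemma depth_substP [simp]: "depth (substP k X F A) = depth A"
  by (induction A) auto

function falsity :: "process set \<Rightarrow> formula \<Rightarrow> stack set" where
  "falsity P (PVar X as) = {}"
| "falsity P Top = {}"
| "falsity P Bot = stacks"
| "falsity P (A \<rightarrow>\<^sub>f B) = {t \<cdot> \<pi> |t \<pi>. t \<in> orth P (falsity P A) \<and> \<pi> \<in> falsity P B}"
| "falsity P (AllN x A) = (\<Union>m. falsity P (substN x m A))"
| "falsity P (AllP k X A) = (\<Union>F\<in>preds k. falsity P (substP k X F A))"
| "falsity P (EqImp a b A) = (if val a = val b then falsity P A else {})"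
| "falsity P (A \<inter>\<^sub>f B) = falsity P A \<union> falsity P B"
| "falsity P (A \<union>\<^sub>f B) = falsity P A \<inter> falsity P B"
| "falsity P (Param F as) = F (map val as)"
  by pat_completeness auto
termination by (relation "measure (\<lambda>(P, A). depth A)") auto

definition truth :: "process set \<Rightarrow> formula \<Rightarrow> trm set" where
  "truth P A = orth P (falsity P A)"

definition realizes :: "process set \<Rightarrow> trm \<Rightarrow> formula \<Rightarrow> bool" where
  "realizes P t A \<longleftrightarrow> t \<in> truth P A"


section \<open>Abbreviations\<close>

text \<open>A name for a 0-ary second-order variable that is free in neither \<open>A\<close> nor \<open>B\<close>.\<close>

definition fresh :: "formula \<Rightarrow> formula \<Rightarrow> nat" where
  "fresh A B = (LEAST Z. (0, Z) \<notin> fvP A \<union> fvP B)"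

definition Eq :: "fo_term \<Rightarrow> fo_term \<Rightarrow> formula" where
  "Eq a b = AllP 1 0 (PVar 0 [a] \<rightarrow>\<^sub>f PVar 0 [b])"

definition Conj :: "formula \<Rightarrow> formula \<Rightarrow> formula" where
  "Conj A B = (let Z = fresh A B in AllP 0 Z ((A \<rightarrow>\<^sub>f B \<rightarrow>\<^sub>f PVar Z []) \<rightarrow>\<^sub>f PVar Z []))"

definition Disj :: "formula \<Rightarrow> formula \<Rightarrow> formula" where
  "Disj A B =
    (let Z = fresh A B in
      AllP 0 Z ((A \<rightarrow>\<^sub>f PVar Z []) \<rightarrow>\<^sub>f (B \<rightarrow>\<^sub>f PVar Z []) \<rightarrow>\<^sub>f PVar Z []))"

definition Iff :: "formula \<Rightarrow> formula \<Rightarrow> formula" where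
  "Iff A B = Conj (A \<rightarrow>\<^sub>f B) (B \<rightarrow>\<^sub>f A)"

fun Disjs :: "formula list \<Rightarrow> formula" where
  "Disjs [] = Bot"
| "Disjs [A] = A"
| "Disjs (A # B # As) = Disj A (Disjs (B # As))"

definition universally_equivalent :: "formula \<Rightarrow> formula \<Rightarrow> bool" where
  "universally_equivalent A B \<longleftrightarrow> closed_formula A \<and> closed_formula B \<and>
     (\<exists>t. proof_like t \<and> (\<forall>P. pole P \<longrightarrow> realizes P t (Iff A B)))"


section \<open>\<open>POR\<close> and \<open>\<gimel>\<^sub>2\<close>\<close>

definition BoolF :: "fo_term \<Rightarrow> formula" where
  "BoolF y = AllP 1 0 (PVar 0 [Num 0] \<rightarrow>\<^sub>f PVar 0 [Num 1] \<rightarrow>\<^sub>f PVar 0 [y])"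

definition POR :: formula where
  "POR = (BoolF (Num 1) \<rightarrow>\<^sub>f Top \<rightarrow>\<^sub>f BoolF (Num 1)) \<inter>\<^sub>f
         (Top \<rightarrow>\<^sub>f BoolF (Num 1) \<rightarrow>\<^sub>f BoolF (Num 1)) \<inter>\<^sub>f
         (BoolF (Num 0) \<rightarrow>\<^sub>f BoolF (Num 0) \<rightarrow>\<^sub>f BoolF (Num 0))"

definition plus_fo :: "fo_term \<Rightarrow> fo_term \<Rightarrow> fo_term" where
  "plus_fo a b = Fn (\<lambda>v. v ! 0 + v ! 1) [a, b]"

definition min_fo :: "fo_term \<Rightarrow> fo_term \<Rightarrow> fo_term" where
  "min_fo a b = Fn (\<lambda>v. min (v ! 0) (v ! 1)) [a, b]"

text \<open>\<open>\<gimel>\<^sub>2(a) \<hookrightarrow> A\<close>, where \<open>\<gimel>\<^sub>2(a)\<close> is the equation \<open>min(a + 1, 2) = a + 1\<close>.\<close>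

definition Gimel2Imp :: "fo_term \<Rightarrow> formula \<Rightarrow> formula" where
  "Gimel2Imp a A = EqImp (min_fo (plus_fo a (Num 1)) (Num 2)) (plus_fo a (Num 1)) A"

text \<open>\<open>\<gimel>\<^sub>2 \<Turnstile> A\<close>: only first-order quantifiers are relativized. The second-order quantifiers
  hidden in \<open>=\<close>, \<open>\<and>\<close> and \<open>\<or>\<close> are left as they are.\<close>

primrec gimel2_models :: "formula \<Rightarrow> formula" where
  "gimel2_models (PVar X as) = PVar X as"
| "gimel2_models Top = Top"
| "gimel2_models Bot = Bot"
| "gimel2_models (A \<rightarrow>\<^sub>f B) = (gimel2_models A \<rightarrow>\<^sub>f gimel2_models B)"
| "gimel2_models (AllN x A) = AllN x (Gimel2Imp (FVar x) (gimel2_models A))"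
| "gimel2_models (AllP k X A) = AllP k X (gimel2_models A)"
| "gimel2_models (EqImp a b A) = EqImp a b (gimel2_models A)"
| "gimel2_models (A \<inter>\<^sub>f B) = (gimel2_models A \<inter>\<^sub>f gimel2_models B)"
| "gimel2_models (A \<union>\<^sub>f B) = (gimel2_models A \<union>\<^sub>f gimel2_models B)"
| "gimel2_models (Param F as) = Param F as"

definition gimel2_le_4 :: formula where
  "gimel2_le_4 = gimel2_models (AllN 1 (AllN 2 (AllN 3 (AllN 4 (AllN 5
     (Disjs [Eq (FVar i) (FVar j). i \<leftarrow> [1, 2, 3, 4, 5], j \<leftarrow> [1, 2, 3, 4, 5], i \<noteq> j]))))))"

end

theory Submission
  imports Defs
begin

text \<open>
  Both formulas amount to a majority operation. If \<open>p\<close> realizes \<open>POR\<close>, then \<open>p a b a c\<close> realizes \<open>\<bottom>\<close> as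
  soon as two of \<open>a\<close>, \<open>b\<close>, \<open>c\<close> do. Two maps \<open>{1..5} \<rightarrow> {0, 1}\<close> always identify a common pair \<open>i \<noteq> j\<close>, so
  the sets of pairs that such maps identify form an intersecting family, and nested majorities turn
  an intersecting family of hypotheses into one term that realizes \<open>\<bottom>\<close> whenever all members of some
  set of the family do; \<open>cc\<close> then gives the disjunction. Conversely, instantiating the five variables
  of \<open>|\<gimel>\<^sub>2| \<le> 4\<close> by distinct vertices of the cube \<open>{0, 1}\<^sup>3\<close> yields the majority of \<open>a\<close>, \<open>b\<close>, \<open>c\<close> in any
  formula, and the majority of \<open>U t u\<close>, \<open>V t u\<close> and \<open>u\<close> is a parallel or of \<open>U\<close> and \<open>V\<close>.
\<close>

section \<open>Evaluation and orthogonality\<close>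

lemma wf_trm_mono: "wf_trm m t \<Longrightarrow> m \<le> n \<Longrightarrow> wf_trm n t"
  and "wf_stack \<pi> \<Longrightarrow> True"
  by (induction m t and \<pi> arbitrary: n rule: wf_trm_wf_stack.induct) auto

lemma wf_trm_closed: "wf_trm 0 t \<Longrightarrow> wf_trm n t"
  using wf_trm_mono by blast

lemma wf_trm_closed_simps [simp]:
  "wf_trm 0 t \<Longrightarrow> wf_trm (Suc n) t" "wf_trm 0 t \<Longrightarrow> wf_trm (numeral k) t"
  using wf_trm_mono by blast+

lemma subst_trm_fresh: "wf_trm n t \<Longrightarrow> n \<le> k \<Longrightarrow> subst_trm t k u = t"
  and "wf_stack \<pi> \<Longrightarrow> True"
  by (induction n t and \<pi> arbitrary: k rule: wf_trm_wf_stack.induct) auto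

lemma subst_trm_closed [simp]: "wf_trm 0 t \<Longrightarrow> subst_trm t k u = t"
  using subst_trm_fresh by blast

lemma wf_subst_trm: "wf_trm (Suc n) t \<Longrightarrow> k \<le> n \<Longrightarrow> wf_trm 0 u \<Longrightarrow> wf_trm n (subst_trm t k u)"
  by (induction t arbitrary: n k rule: trm.induct[where ?P2.0 = "\<lambda>_. True"])
    (auto intro: wf_trm_closed)

lemma pole_wf: "pole P \<Longrightarrow> (t, \<pi>) \<in> P \<Longrightarrow> wf_trm 0 t \<and> wf_stack \<pi>"
  unfolding pole_def processes_def terms_def stacks_def by auto

lemma pole_eval1: "pole P \<Longrightarrow> p \<succ>\<^sub>1 q \<Longrightarrow> q \<in> P \<Longrightarrow> p \<in> P"
  unfolding pole_def by blast

lemma pole_App: "pole P \<Longrightarrow> (t, u \<cdot> \<pi>) \<in> P \<Longrightarrow> (App t u, \<pi>) \<in> P"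
  by (frule (1) pole_wf, erule pole_eval1[OF _ push])
    (auto simp: processes_def terms_def stacks_def)

text \<open>Unlike for \<open>push\<close>, closedness of the argument cannot be read off from the
  reduct: the substitution may erase \<open>u\<close>.\<close>

lemma pole_Lam:
  "pole P \<Longrightarrow> wf_trm 1 t \<Longrightarrow> wf_trm 0 u \<Longrightarrow> (subst_trm t 0 u, \<pi>) \<in> P \<Longrightarrow> (Lam t, u \<cdot> \<pi>) \<in> P"
  by (frule (1) pole_wf, erule pole_eval1[OF _ grab])
    (auto simp: processes_def terms_def stacks_def)

text \<open>The outer abstraction is consumed first, so \<open>a\<close> replaces index 1 and only
  then does \<open>b\<close> replace index 0.\<close>

lemma pole_Lam2:
  assumes "pole P" "wf_trm 2 t" "wf_trm 0 a" "wf_trm 0 b"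
    and "(subst_trm (subst_trm t 1 a) 0 b, \<pi>) \<in> P"
  shows "(Lam (Lam t), a \<cdot> b \<cdot> \<pi>) \<in> P"
  using assms by (intro pole_Lam) (auto simp: numeral_2_eq_2 intro!: pole_Lam wf_subst_trm)

lemma numeral_4_5: "(4::nat) = Suc (Suc (Suc (Suc 0)))" "(5::nat) = Suc (Suc (Suc (Suc (Suc 0))))"
  by simp_all

lemma pole_Lam4:
  assumes "pole P" "wf_trm 4 t" "wf_trm 0 a" "wf_trm 0 b" "wf_trm 0 c" "wf_trm 0 d"
    and "(subst_trm (subst_trm (subst_trm (subst_trm t 3 a) 2 b) 1 c) 0 d, \<pi>) \<in> P"
  shows "(Lam (Lam (Lam (Lam t))), a \<cdot> b \<cdot> c \<cdot> d \<cdot> \<pi>) \<in> P"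
proof -
  have "wf_trm 2 (subst_trm (subst_trm t 3 a) 2 b)"
    using assms(2-4) by (intro wf_subst_trm) (simp_all add: numeral_2_eq_2 numeral_3_eq_3 numeral_4_5)
  then have "(Lam (Lam (subst_trm (subst_trm t 3 a) 2 b)), c \<cdot> d \<cdot> \<pi>) \<in> P"
    using assms by (intro pole_Lam2) simp_all
  then show ?thesis
    using assms(1-4) by (intro pole_Lam2) (simp_all add: numeral_2_eq_2 numeral_3_eq_3 numeral_4_5)
qed

lemma pole_Lam5:
  assumes "pole P" "wf_trm 5 t" "wf_trm 0 a" "wf_trm 0 b" "wf_trm 0 c" "wf_trm 0 d" "wf_trm 0 e"
    and "(subst_trm (subst_trm (subst_trm (subst_trm (subst_trm t 4 a) 3 b) 2 c) 1 d) 0 e, \<pi>) \<in> P"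
  shows "(Lam (Lam (Lam (Lam (Lam t)))), a \<cdot> b \<cdot> c \<cdot> d \<cdot> e \<cdot> \<pi>) \<in> P"
proof -
  have "wf_trm 4 (subst_trm t 4 a)"
    using assms(2,3) by (intro wf_subst_trm) (simp_all add: numeral_4_5)
  then have "(Lam (Lam (Lam (Lam (subst_trm t 4 a)))), b \<cdot> c \<cdot> d \<cdot> e \<cdot> \<pi>) \<in> P"
    using assms by (intro pole_Lam4) simp_all
  then show ?thesis
    using assms(1-3) by (intro pole_Lam) (simp_all add: numeral_2_eq_2 numeral_3_eq_3 numeral_4_5)
qed

lemma pole_CC: "pole P \<Longrightarrow> (t, Cont \<pi> \<cdot> \<pi>) \<in> P \<Longrightarrow> (CC, t \<cdot> \<pi>) \<in> P"
  by (frule (1) pole_wf, erule pole_eval1[OF _ save])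
    (auto simp: processes_def terms_def stacks_def)

lemma pole_Cont: "pole P \<Longrightarrow> wf_stack \<pi> \<Longrightarrow> (t, \<pi>') \<in> P \<Longrightarrow> (Cont \<pi>', t \<cdot> \<pi>) \<in> P"
  by (frule (1) pole_wf, erule pole_eval1[OF _ restore])
    (auto simp: processes_def terms_def stacks_def)

lemma orthI: "wf_trm 0 t \<Longrightarrow> (\<And>\<pi>. \<pi> \<in> S \<Longrightarrow> (t, \<pi>) \<in> P) \<Longrightarrow> t \<in> orth P S"
  by (simp add: orth_def terms_def)

lemma orth_wf: "t \<in> orth P S \<Longrightarrow> wf_trm 0 t"
  by (simp add: orth_def terms_def)

lemma orthD: "t \<in> orth P S \<Longrightarrow> \<pi> \<in> S \<Longrightarrow> (t, \<pi>) \<in> P"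
  by (simp add: orth_def)

lemma orth_empty: "t \<in> orth P {} \<longleftrightarrow> wf_trm 0 t"
  by (simp add: orth_def terms_def)

lemma orth_mono: "t \<in> orth P S \<Longrightarrow> S' \<subseteq> S \<Longrightarrow> t \<in> orth P S'"
  unfolding orth_def by blast


section \<open>Falsity values\<close>

lemma wf_params_substN [simp]: "wf_params (substN x m A) = wf_params A"
  by (induction A) auto

lemma wf_params_substP: "wf_params A \<Longrightarrow> F \<in> preds k \<Longrightarrow> wf_params (substP k X F A)"
  by (induction A) auto

text \<open>Hence a term orthogonal to \<open>stacks\<close> realizes every formula with well-formed
  parameters, and the stack that \<open>cc\<close> saves is closed.\<close>

lemma falsity_subset_stacks: "wf_params A \<Longrightarrow> falsity P A \<subseteq> stacks"
proof (induction P A rule: falsity.induct)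
  case (4 P A B)
  then show ?case by (auto simp: stacks_def dest: orth_wf)
next
  case (6 P k X A)
  then show ?case by (fastforce dest: wf_params_substP)
next
  case (7 P a b A)
  then show ?case by auto
next
  case (10 P F as)
  then show ?case by (auto simp: preds_def)
qed auto

lemma fvP_substN [simp]: "fvP (substN x m A) = fvP A"
  by (induction A) auto

lemma fvP_gimel2_models [simp]: "fvP (gimel2_models A) = fvP A"
  by (induction A) (auto simp: Gimel2Imp_def)

lemma finite_fvP: "finite (fvP A)"
  by (induction A) auto

lemma substP_fresh: "(k, X) \<notin> fvP A \<Longrightarrow> substP k X F A = A"
  by (induction A) auto

lemma fresh_notin: "(0, fresh A B) \<notin> fvP A" "(0, fresh A B) \<notin> fvP B"
proof -
  have "finite (Pair 0 -` (fvP A \<union> fvP B))"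
    by (intro finite_vimageI) (auto simp: finite_fvP inj_def)
  then obtain Z where "Z \<notin> Pair (0::nat) -` (fvP A \<union> fvP B)"
    using ex_new_if_finite[OF infinite_UNIV_nat] by metis
  then have "(0, Z) \<notin> fvP A \<union> fvP B"
    by simp
  from LeastI[of "\<lambda>Z. (0, Z) \<notin> fvP A \<union> fvP B", OF this]
  show "(0, fresh A B) \<notin> fvP A" "(0, fresh A B) \<notin> fvP B"
    unfolding fresh_def by auto
qed

text \<open>Only the value at \<open>[]\<close> of a nullary predicate matters, so the quantifier
  over \<open>Z\<close> hidden in \<open>Disj\<close> and \<open>Conj\<close> amounts to one over
  sets of stacks.\<close>

lemma ex_pred0: "(\<exists>F\<in>preds 0. Q (F [])) \<longleftrightarrow> (\<exists>S\<subseteq>stacks. Q S)"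
proof
  show "\<exists>F\<in>preds 0. Q (F [])" if "\<exists>S\<subseteq>stacks. Q S"
  proof -
    from that obtain S where "S \<subseteq> stacks" "Q S" by blast
    then show ?thesis by (intro bexI[of _ "\<lambda>_. S"]) (auto simp: preds_def)
  qed
qed (auto simp: preds_def)

lemma falsity_Disj:
  "\<rho> \<in> falsity P (Disj A B) \<longleftrightarrow> (\<exists>S\<subseteq>stacks. \<exists>a b \<pi>. \<rho> = a \<cdot> b \<cdot> \<pi> \<and> \<pi> \<in> S \<and>
     a \<in> orth P {t \<cdot> \<pi> |t \<pi>. t \<in> truth P A \<and> \<pi> \<in> S} \<and>
     b \<in> orth P {t \<cdot> \<pi> |t \<pi>. t \<in> truth P B \<and> \<pi> \<in> S})"
  by (simp add: Disj_def Let_def substP_fresh fresh_notin truth_def ex_pred0 [symmetric])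
    (rule bex_cong[OF refl]; blast)

lemma falsity_Conj:
  "\<rho> \<in> falsity P (Conj A B) \<longleftrightarrow> (\<exists>S\<subseteq>stacks. \<exists>a \<pi>. \<rho> = a \<cdot> \<pi> \<and> \<pi> \<in> S \<and>
     a \<in> orth P {t \<cdot> u \<cdot> \<pi> |t u \<pi>. t \<in> truth P A \<and> u \<in> truth P B \<and> \<pi> \<in> S})"
proof -
  have eq: "{t \<cdot> \<pi> |t \<pi>. t \<in> X \<and> (\<exists>t' \<pi>'. \<pi> = t' \<cdot> \<pi>' \<and> t' \<in> Y \<and> \<pi>' \<in> S)}
    = {t \<cdot> u \<cdot> \<pi> |t u \<pi>. t \<in> X \<and> u \<in> Y \<and> \<pi> \<in> S}" for X Y S
    by blast
  show ?thesis
    by (simp add: Conj_def Let_def substP_fresh fresh_notin truth_def ex_pred0 [symmetric] eq)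
      (rule bex_cong[OF refl]; blast)
qed

lemma val_Num [simp]: "val (Num m) = m"
  by (simp add: Num_def)

lemma falsity_Eq:
  "falsity P (Eq (Num a) (Num b)) =
    (\<Union>F\<in>preds 1. {t \<cdot> \<pi> |t \<pi>. t \<in> orth P (F [a]) \<and> \<pi> \<in> F [b]})"
  by (simp add: Eq_def)

text \<open>Among the predicates with value \<open>S\<close> at \<open>b\<close>, the one that is
  empty elsewhere constrains the branches least: a branch that is not selected need only be
  closed.\<close>

lemma falsity_BoolF:
  "\<rho> \<in> falsity P (BoolF (Num b)) \<longleftrightarrow> (\<exists>S\<subseteq>stacks. \<exists>t u \<pi>. \<rho> = t \<cdot> u \<cdot> \<pi> \<and> \<pi> \<in> S \<and> wf_trm 0 t \<and> wf_trm 0 u \<and>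
     (b = 0 \<longrightarrow> t \<in> orth P S) \<and> (b = 1 \<longrightarrow> u \<in> orth P S))" (is "?L \<longleftrightarrow> ?R")
proof -
  have L: "?L \<longleftrightarrow> (\<exists>F\<in>preds 1. \<exists>t u \<pi>. \<rho> = t \<cdot> u \<cdot> \<pi> \<and> t \<in> orth P (F [0]) \<and> u \<in> orth P (F [1]) \<and> \<pi> \<in> F [b])"
    by (auto simp: BoolF_def)
  show ?thesis
  proof
    assume ?L
    then obtain F t u \<pi> where F: "F \<in> preds 1" "\<rho> = t \<cdot> u \<cdot> \<pi>" "t \<in> orth P (F [0])"
      "u \<in> orth P (F [1])" "\<pi> \<in> F [b]"
      unfolding L by blast
    moreover have "F [b] \<subseteq> stacks"
      using F(1) by (simp add: preds_def)
    ultimately show ?R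
      by (intro exI[of _ "F [b]"]) (auto dest: orth_wf)
  next
    assume ?R
    then obtain S t u \<pi> where S: "S \<subseteq> stacks" "\<rho> = t \<cdot> u \<cdot> \<pi>" "\<pi> \<in> S" "wf_trm 0 t" "wf_trm 0 u"
      "b = 0 \<longrightarrow> t \<in> orth P S" "b = 1 \<longrightarrow> u \<in> orth P S"
      by blast
    then show ?L
      unfolding L by (intro bexI[of _ "\<lambda>v. if v = [b] then S else {}"]) (auto simp: orth_empty preds_def)
  qed
qed

lemma BoolF_elim:
  assumes "pole P" "U \<in> truth P (BoolF (Num b))" "S \<subseteq> stacks" "wf_trm 0 t" "wf_trm 0 u"
    and "b = 0 \<Longrightarrow> t \<in> orth P S" "b = 1 \<Longrightarrow> u \<in> orth P S"
  shows "App (App U t) u \<in> orth P S"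
proof (rule orthI)
  show "wf_trm 0 (App (App U t) u)"
    using assms by (auto simp: truth_def dest: orth_wf)
next
  fix \<pi> assume "\<pi> \<in> S"
  then have "t \<cdot> u \<cdot> \<pi> \<in> falsity P (BoolF (Num b))"
    using assms(3-7) unfolding falsity_BoolF by blast
  then show "(App (App U t) u, \<pi>) \<in> P"
    using assms(1,2) by (auto simp: truth_def intro!: pole_App dest: orthD)
qed

text \<open>The falsity value of an intersection is a union, hence three cases; \<open>Top\<close>
  accepts every closed term.\<close>

lemma falsity_POR:
  "\<rho> \<in> falsity P POR \<longleftrightarrow> (\<exists>U V \<rho>'. \<rho> = U \<cdot> V \<cdot> \<rho>' \<and> wf_trm 0 U \<and> wf_trm 0 V \<and>
    (U \<in> truth P (BoolF (Num 1)) \<and> \<rho>' \<in> falsity P (BoolF (Num 1)) \<or>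
     V \<in> truth P (BoolF (Num 1)) \<and> \<rho>' \<in> falsity P (BoolF (Num 1)) \<or>
     U \<in> truth P (BoolF (Num 0)) \<and> V \<in> truth P (BoolF (Num 0)) \<and> \<rho>' \<in> falsity P (BoolF (Num 0))))"
  by (auto simp: POR_def truth_def orth_empty dest: orth_wf)

section \<open>Realizers for disjunction and equality\<close>

lemma DisjI1:
  assumes "pole P" "u \<in> truth P A"
  shows "Lam (Lam (App (Var 1) u)) \<in> truth P (Disj A B)"
  unfolding truth_def
proof (rule orthI)
  have u: "wf_trm 0 u"
    using assms(2) by (auto simp: truth_def dest: orth_wf)
  then show "wf_trm 0 (Lam (Lam (App (Var 1) u)))"
    by simp
  fix \<rho> assume "\<rho> \<in> falsity P (Disj A B)"
  then obtain S a b \<pi> where \<rho>: "\<rho> = a \<cdot> b \<cdot> \<pi>" "\<pi> \<in> S" "wf_trm 0 a" "wf_trm 0 b"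
    "a \<in> orth P {t \<cdot> \<pi> |t \<pi>. t \<in> truth P A \<and> \<pi> \<in> S}"
    unfolding falsity_Disj by (blast dest: orth_wf)
  then have "(a, u \<cdot> \<pi>) \<in> P"
    using assms(2) by (blast intro: orthD)
  then show "(Lam (Lam (App (Var 1) u)), \<rho>) \<in> P"
    using assms(1) u \<rho>(3,4) unfolding \<rho>(1) by (auto intro!: pole_Lam2 pole_App)
qed

lemma DisjI2:
  assumes "pole P" "u \<in> truth P B"
  shows "Lam (Lam (App (Var 0) u)) \<in> truth P (Disj A B)"
  unfolding truth_def
proof (rule orthI)
  have u: "wf_trm 0 u"
    using assms(2) by (auto simp: truth_def dest: orth_wf)
  then show "wf_trm 0 (Lam (Lam (App (Var 0) u)))"
    by simp
  fix \<rho> assume "\<rho> \<in> falsity P (Disj A B)"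
  then obtain S a b \<pi> where \<rho>: "\<rho> = a \<cdot> b \<cdot> \<pi>" "\<pi> \<in> S" "wf_trm 0 a" "wf_trm 0 b"
    "b \<in> orth P {t \<cdot> \<pi> |t \<pi>. t \<in> truth P B \<and> \<pi> \<in> S}"
    unfolding falsity_Disj by (blast dest: orth_wf)
  then have "(b, u \<cdot> \<pi>) \<in> P"
    using assms(2) by (blast intro: orthD)
  then show "(Lam (Lam (App (Var 0) u)), \<rho>) \<in> P"
    using assms(1) u \<rho>(3,4) unfolding \<rho>(1) by (auto intro!: pole_Lam2 pole_App)
qed

lemma Disj_elim:
  assumes "pole P" "d \<in> truth P (Disj A B)" "S \<subseteq> stacks" "wf_trm 0 f" "wf_trm 0 g"
    and f: "\<And>t \<pi>. t \<in> truth P A \<Longrightarrow> \<pi> \<in> S \<Longrightarrow> (f, t \<cdot> \<pi>) \<in> P"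
    and g: "\<And>t \<pi>. t \<in> truth P B \<Longrightarrow> \<pi> \<in> S \<Longrightarrow> (g, t \<cdot> \<pi>) \<in> P"
  shows "App (App d f) g \<in> orth P S"
proof (rule orthI)
  show "wf_trm 0 (App (App d f) g)"
    using assms by (auto simp: truth_def dest: orth_wf)
next
  fix \<pi> assume "\<pi> \<in> S"
  moreover have "f \<in> orth P {t \<cdot> \<pi> |t \<pi>. t \<in> truth P A \<and> \<pi> \<in> S}"
    using assms(4) f by (auto intro: orthI)
  moreover have "g \<in> orth P {t \<cdot> \<pi> |t \<pi>. t \<in> truth P B \<and> \<pi> \<in> S}"
    using assms(5) g by (auto intro: orthI)
  ultimately have "f \<cdot> g \<cdot> \<pi> \<in> falsity P (Disj A B)"
    using assms(3) unfolding falsity_Disj by blast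
  then show "(App (App d f) g, \<pi>) \<in> P"
    using assms(1,2) by (auto simp: truth_def intro!: pole_App dest: orthD)
qed

lemma Id_realizes_Eq: "pole P \<Longrightarrow> Lam (Var 0) \<in> truth P (Eq (Num a) (Num a))"
  unfolding truth_def falsity_Eq
  by (rule orthI) (auto intro!: pole_Lam dest: orth_wf orthD)

text \<open>For \<open>a \<noteq> b\<close>, the formula \<open>a = b\<close> has the same realizers as \<open>\<top> \<rightarrow> \<bottom>\<close>.\<close>

lemma Eq_elim:
  assumes "pole P" "e \<in> truth P (Eq (Num a) (Num b))" "S \<subseteq> stacks" "wf_trm 0 c"
    and "a = b \<Longrightarrow> c \<in> orth P S"
  shows "App e c \<in> orth P S"
proof (rule orthI)
  show "wf_trm 0 (App e c)"
    using assms by (auto simp: truth_def dest: orth_wf)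
next
  fix \<pi> assume "\<pi> \<in> S"
  \<comment> \<open>If \<open>a\<close> differs from \<open>b\<close>, this predicate is empty at
    \<open>a\<close>, so closedness of \<open>c\<close> suffices.\<close>
  let ?F = "\<lambda>v. if v = [b] then S else {}"
  have "?F \<in> preds 1"
    using assms(3) by (auto simp: preds_def)
  moreover have "c \<in> orth P (?F [a])"
    using assms(4,5) by (auto simp: orth_empty)
  moreover have "\<pi> \<in> ?F [b]"
    using \<open>\<pi> \<in> S\<close> by simp
  ultimately have "c \<cdot> \<pi> \<in> falsity P (Eq (Num a) (Num b))"
    unfolding falsity_Eq by blast
  then show "(App e c, \<pi>) \<in> P"
    using assms(1,2) by (auto simp: truth_def intro: pole_App orthD)
qed


section \<open>The formula \<open>|\<gimel>\<^sub>2| \<le> 4\<close>\<close>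

text \<open>Fixes the order of the twenty disjuncts; below, a disjunct is named by its position in
  this list.\<close>

definition pairs :: "(nat \<times> nat) list" where
  "pairs = (let L = [1, 2, 3, 4, 5] in [(i, j). i \<leftarrow> L, j \<leftarrow> L, i \<noteq> j])"

lemma set_pairs: "set pairs = {(i, j). i \<in> {1, 2, 3, 4, 5} \<and> j \<in> {1, 2, 3, 4, 5} \<and> i \<noteq> j}"
proof -
  have "set [(i, j). i \<leftarrow> L, j \<leftarrow> L, i \<noteq> j] = {(i, j). i \<in> set L \<and> j \<in> set L \<and> i \<noteq> j}" for L :: "nat list"
    by auto
  moreover have "{1, 2, 3, 4, 5::nat} = set [1, 2, 3, 4, 5]"
    by simp
  ultimately show ?thesis
    unfolding pairs_def Let_def by (simp only:)
qed

text \<open>With the terms as a parameter, instantiating first-order variables changes only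
  \<open>a\<close>.\<close>

definition eqs :: "(nat \<Rightarrow> fo_term) \<Rightarrow> formula" where
  "eqs a = Disjs (map (\<lambda>p. Eq (a (fst p)) (a (snd p))) pairs)"

text \<open>The name chosen by \<open>fresh\<close> depends only on free second-order variables,
  which \<open>substN\<close> preserves, so both sides bind the same name.\<close>

lemma substN_Disj: "substN x m (Disj A B) = Disj (substN x m A) (substN x m B)"
  by (simp add: Disj_def Let_def fresh_def)

lemma substN_Disjs: "substN x m (Disjs As) = Disjs (map (substN x m) As)"
  by (induction As rule: Disjs.induct) (auto simp: substN_Disj)

lemma substN_eqs: "substN x m (eqs a) = eqs (\<lambda>i. subst_fo x m (a i))"
  by (simp add: eqs_def substN_Disjs comp_def Eq_def)

lemma gimel2_models_Disj: "gimel2_models (Disj A B) = Disj (gimel2_models A) (gimel2_models B)"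
  by (simp add: Disj_def Let_def fresh_def)

lemma gimel2_models_Disjs: "gimel2_models (Disjs As) = Disjs (map gimel2_models As)"
  by (induction As rule: Disjs.induct) (auto simp: gimel2_models_Disj)

lemma gimel2_models_eqs: "gimel2_models (eqs a) = eqs a"
  by (simp add: eqs_def gimel2_models_Disjs comp_def Eq_def)

lemma gimel2_le_4_eq:
  "gimel2_le_4 = AllN 1 (Gimel2Imp (FVar 1) (AllN 2 (Gimel2Imp (FVar 2) (AllN 3 (Gimel2Imp (FVar 3)
    (AllN 4 (Gimel2Imp (FVar 4) (AllN 5 (Gimel2Imp (FVar 5) (eqs FVar))))))))))"
proof -
  have "[Eq (FVar i) (FVar j). i \<leftarrow> [1, 2, 3, 4, 5], j \<leftarrow> [1, 2, 3, 4, 5], i \<noteq> j] =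
    map (\<lambda>p. Eq (FVar (fst p)) (FVar (snd p))) pairs"
    by (simp add: pairs_def)
  then have "gimel2_le_4 = gimel2_models (AllN 1 (AllN 2 (AllN 3 (AllN 4 (AllN 5 (eqs FVar))))))"
    unfolding gimel2_le_4_def eqs_def by (rule arg_cong)
  then show ?thesis
    by (simp add: gimel2_models_eqs)
qed

lemma eqs_cong: "(\<And>i. i \<in> {1, 2, 3, 4, 5} \<Longrightarrow> a i = b i) \<Longrightarrow> eqs a = eqs b"
  unfolding eqs_def by (rule arg_cong[where f = Disjs]) (auto simp: set_pairs)

lemma subst_fo_Num [simp]: "subst_fo x m (Num k) = Num k"
  by (simp add: Num_def)

text \<open>The equation min(m + 1, 2) = m + 1 holds exactly for m = 0 and m = 1.\<close>

lemma falsity_AllN_Gimel2Imp: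
  "falsity P (AllN n (Gimel2Imp (FVar n) A)) = (\<Union>m\<in>{..1}. falsity P (substN n m A))"
  by (force simp: Gimel2Imp_def min_fo_def plus_fo_def)

lemma substN_AllN_Gimel2Imp:
  "n \<noteq> y \<Longrightarrow> substN y m (AllN n (Gimel2Imp (FVar n) A)) = AllN n (Gimel2Imp (FVar n) (substN y m A))"
  by (simp add: Gimel2Imp_def min_fo_def plus_fo_def)

lemma falsity_gimel2_le_4:
  "falsity P gimel2_le_4 = (\<Union>x\<in>{x. \<forall>i. x i \<le> 1}. falsity P (eqs (\<lambda>i. Num (x i))))"
    (is "?L = ?R")
proof -
  let ?a = "\<lambda>m1 m2 m3 m4 m5 i.
    subst_fo 5 m5 (subst_fo 4 m4 (subst_fo 3 m3 (subst_fo 2 m2 (subst_fo 1 m1 (FVar i)))))"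
  have L: "\<rho> \<in> ?L \<longleftrightarrow> (\<exists>m1\<le>1. \<exists>m2\<le>1. \<exists>m3\<le>1. \<exists>m4\<le>1. \<exists>m5\<le>1.
      \<rho> \<in> falsity P (eqs (?a m1 m2 m3 m4 m5)))" for \<rho>
    by (simp add: gimel2_le_4_eq falsity_AllN_Gimel2Imp substN_AllN_Gimel2Imp substN_eqs Bex_def
        del: falsity.simps(5) substN.simps(5) subst_fo.simps(1))
  show ?thesis
  proof (intro set_eqI iffI)
    fix \<rho> assume "\<rho> \<in> ?L"
    then obtain m1 m2 m3 m4 m5 where m: "m1 \<le> 1" "m2 \<le> 1" "m3 \<le> 1" "m4 \<le> 1" "m5 \<le> 1"
      and \<rho>: "\<rho> \<in> falsity P (eqs (?a m1 m2 m3 m4 m5))"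
      unfolding L by blast
    \<comment> \<open>The default 0 keeps the bound at all indices; \<open>eqs\<close> only looks at
      1 to 5.\<close>
    let ?x = "(\<lambda>_::nat. 0)(1 := m1, 2 := m2, 3 := m3, 4 := m4, 5 := m5)"
    have eq: "eqs (?a m1 m2 m3 m4 m5) = eqs (\<lambda>i. Num (?x i))"
      by (rule eqs_cong) auto
    have "?x \<in> {x. \<forall>i. x i \<le> 1}"
      using m by auto
    then show "\<rho> \<in> ?R"
      using \<rho> unfolding eq by (rule UN_I[of ?x])
  next
    fix \<rho> assume "\<rho> \<in> ?R"
    then obtain x where x: "\<And>i. x i \<le> 1" and \<rho>: "\<rho> \<in> falsity P (eqs (\<lambda>i. Num (x i)))"
      by auto
    have "eqs (\<lambda>i. Num (x i)) = eqs (?a (x 1) (x 2) (x 3) (x 4) (x 5))"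
      by (rule eqs_cong) auto
    with x \<rho> show "\<rho> \<in> ?L"
      unfolding L by metis
  qed
qed

section \<open>Closedness of both formulas\<close>

lemma fvP_Disj: "fvP A = {} \<Longrightarrow> fvP B = {} \<Longrightarrow> fvP (Disj A B) = {}"
  by (simp add: Disj_def Let_def)

lemma fvP_Disjs: "\<forall>A\<in>set As. fvP A = {} \<Longrightarrow> fvP (Disjs As) = {}"
  by (induction As rule: Disjs.induct) (auto simp: fvP_Disj)

lemma fvN_Disjs: "fvN (Disjs As) = (\<Union>A\<in>set As. fvN A)"
  by (induction As rule: Disjs.induct) (auto simp: Disj_def Let_def)

lemma wf_params_Disjs: "\<forall>A\<in>set As. wf_params A \<Longrightarrow> wf_params (Disjs As)"
  by (induction As rule: Disjs.induct) (auto simp: Disj_def Let_def)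

lemma wf_params_eqs: "wf_params (eqs a)"
  unfolding eqs_def by (rule wf_params_Disjs) (auto simp: Eq_def)

lemma closed_gimel2_le_4: "closed_formula gimel2_le_4"
proof -
  have "fvP (eqs FVar) = {}"
    unfolding eqs_def by (rule fvP_Disjs) (auto simp: Eq_def)
  moreover have "fvN (eqs FVar) \<subseteq> {1, 2, 3, 4, 5}"
    unfolding eqs_def fvN_Disjs by (auto simp: Eq_def set_pairs)
  ultimately show ?thesis
    by (auto simp: closed_formula_def gimel2_le_4_eq Gimel2Imp_def min_fo_def plus_fo_def Num_def
        wf_params_eqs)
qed

lemma closed_POR: "closed_formula POR"
  by (simp add: closed_formula_def POR_def BoolF_def Num_def)


section \<open>From \<open>POR\<close> to \<open>|\<gimel>\<^sub>2| \<le> 4\<close>\<close>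

text \<open>The parallel or of \<open>a\<close> and \<open>b\<close> is run as a Boolean: value 0
  selects \<open>a\<close>, value 1 selects \<open>c\<close>.\<close>

definition maj :: "trm \<Rightarrow> trm \<Rightarrow> trm \<Rightarrow> trm \<Rightarrow> trm" where
  "maj p a b c = App (App (App (App p a) b) a) c"

text \<open>A realizer of \<open>\<bottom>\<close> realizes every formula, so \<open>a\<close> and \<open>b\<close> may be passed to a parallel or as
  Booleans of whichever value is needed.\<close>

lemma maj_bot:
  assumes P: "pole P" and p: "p \<in> truth P POR" and wf: "wf_trm 0 a" "wf_trm 0 b" "wf_trm 0 c"
    and two: "a \<in> orth P stacks \<and> b \<in> orth P stacks \<or> a \<in> orth P stacks \<and> c \<in> orth P stacks \<or>
      b \<in> orth P stacks \<and> c \<in> orth P stacks"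
  shows "maj p a b c \<in> orth P stacks"
proof (rule orthI)
  show "wf_trm 0 (maj p a b c)"
    using wf p by (auto simp: maj_def truth_def dest: orth_wf)
next
  fix \<pi> assume \<pi>: "\<pi> \<in> stacks"
  have Bool: "t \<in> truth P (BoolF (Num m))" if "t \<in> orth P stacks" for t m
    unfolding truth_def using that
    by (rule orth_mono) (rule falsity_subset_stacks, simp add: BoolF_def)
  have "a \<cdot> c \<cdot> \<pi> \<in> falsity P (BoolF (Num 1))" if "c \<in> orth P stacks"
    using that wf \<pi> unfolding falsity_BoolF by auto
  moreover have "a \<cdot> c \<cdot> \<pi> \<in> falsity P (BoolF (Num 0))" if "a \<in> orth P stacks"
    using that wf \<pi> unfolding falsity_BoolF by auto
  \<comment> \<open>If \<open>a\<close> and \<open>b\<close> are good, both are read as the Boolean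
    0 and \<open>a\<close> is selected; otherwise \<open>c\<close> is good, and \<open>a\<close> or
    \<open>b\<close> is read as the Boolean 1.\<close>
  ultimately have "a \<cdot> b \<cdot> a \<cdot> c \<cdot> \<pi> \<in> falsity P POR"
    using two wf Bool unfolding falsity_POR by blast
  then show "(maj p a b c, \<pi>) \<in> P"
    using P p unfolding maj_def by (auto simp: truth_def intro!: pole_App dest: orthD)
qed

text \<open>The induction removes three members \<open>A\<^sub>1\<close>, \<open>A\<^sub>2\<close>, \<open>A\<^sub>3\<close> in turn: every member of the family survives
  in at least two of the three smaller families, so the majority of their terms is in \<open>|\<bottom>|\<close>.\<close>

lemma maj_term_exists:
  fixes l :: "'i \<Rightarrow> trm"
  assumes l: "\<And>n. wf_trm 0 (l n)" "\<And>n. no_cont_no_beta (l n)"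
    and "finite \<F>" "\<And>A B. A \<in> \<F> \<Longrightarrow> B \<in> \<F> \<Longrightarrow> A \<inter> B \<noteq> {}"
  shows "\<exists>M. wf_trm 2 M \<and> no_cont_no_beta M \<and>
    (\<forall>P p k. \<forall>A\<in>\<F>. pole P \<longrightarrow> p \<in> truth P POR \<longrightarrow> wf_trm 0 k \<longrightarrow>
      (\<forall>n\<in>A. App k (l n) \<in> orth P stacks) \<longrightarrow> subst_trm (subst_trm M 1 p) 0 k \<in> orth P stacks)"
  using assms(3,4)
proof (induction \<F> rule: finite_psubset_induct)
  case (psubset \<F>)
  show ?case
  proof (cases "\<exists>A1\<in>\<F>. \<exists>A2\<in>\<F>. \<exists>A3\<in>\<F>. A1 \<noteq> A2 \<and> A1 \<noteq> A3 \<and> A2 \<noteq> A3")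
    case False
    \<comment> \<open>At most two members are left, and any two of them meet (a single one meets
      itself, so it is nonempty).\<close>
    have "\<exists>n. \<forall>A\<in>\<F>. n \<in> A"
    proof (cases "\<F> = {}")
      case False
      then obtain A where A: "A \<in> \<F>" by blast
      obtain B where B: "B \<in> \<F>" "\<F> \<subseteq> {A, B}"
        using A \<open>\<not> (\<exists>A1\<in>\<F>. _ A1)\<close> by (cases "\<F> = {A}") blast+
      then show ?thesis
        using psubset.prems[OF A B(1)] by blast
    qed simp
    then obtain n where "\<forall>A\<in>\<F>. n \<in> A" ..
    \<comment> \<open>In \<open>M\<close>, index 1 stands for the realizer of \<open>POR\<close> and
      index 0 for \<open>k\<close>.\<close>
    then show ?thesis
      using l by (intro exI[of _ "App (Var 0) (l n)"]) (auto simp: truth_def dest: orth_wf)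
  next
    case True
    then obtain A1 A2 A3 where A: "A1 \<in> \<F>" "A2 \<in> \<F>" "A3 \<in> \<F>" "A1 \<noteq> A2" "A1 \<noteq> A3" "A2 \<noteq> A3"
      by blast
    let ?Q = "\<lambda>M \<F>. \<forall>P p k. \<forall>A\<in>\<F>. pole P \<longrightarrow> p \<in> truth P POR \<longrightarrow> wf_trm 0 k \<longrightarrow>
      (\<forall>n\<in>A. App k (l n) \<in> orth P stacks) \<longrightarrow> subst_trm (subst_trm M 1 p) 0 k \<in> orth P stacks"
    have IH: "\<exists>M. wf_trm 2 M \<and> no_cont_no_beta M \<and> ?Q M (\<F> - {A})" if "A \<in> \<F>" for A
      by (rule psubset.IH) (use that psubset.prems in auto)
    obtain M1 where M1: "wf_trm 2 M1" "no_cont_no_beta M1" "?Q M1 (\<F> - {A1})"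
      using IH[OF A(1)] by blast
    obtain M2 where M2: "wf_trm 2 M2" "no_cont_no_beta M2" "?Q M2 (\<F> - {A2})"
      using IH[OF A(2)] by blast
    obtain M3 where M3: "wf_trm 2 M3" "no_cont_no_beta M3" "?Q M3 (\<F> - {A3})"
      using IH[OF A(3)] by blast
    let ?M = "maj (Var 1) M1 M2 M3"
    have "?Q ?M \<F>"
    proof (intro allI ballI impI)
      fix P p k B
      assume B: "B \<in> \<F>" and P: "pole P" and p: "p \<in> truth P POR" and k: "wf_trm 0 k"
        and bot: "\<forall>n\<in>B. App k (l n) \<in> orth P stacks"
      let ?s = "\<lambda>M. subst_trm (subst_trm M 1 p) 0 k"
      have p0: "wf_trm 0 p"
        using p by (auto simp: truth_def dest: orth_wf)
      have wf: "wf_trm 0 (?s M)" if "wf_trm 2 M" for M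
        using that p0 k by (auto simp: numeral_2_eq_2 intro!: wf_subst_trm)
      have *: "?s M \<in> orth P stacks" if "?Q M (\<F> - {A})" "B \<noteq> A" for M A
        using that B P p k bot by blast
      have "maj p (?s M1) (?s M2) (?s M3) \<in> orth P stacks"
        using maj_bot[OF P p wf[OF M1(1)] wf[OF M2(1)] wf[OF M3(1)]]
          *[OF M1(3)] *[OF M2(3)] *[OF M3(3)] A(4-6) by metis
      then show "?s ?M \<in> orth P stacks"
        using p0 by (simp add: maj_def)
    qed
    moreover have "wf_trm 2 ?M" "no_cont_no_beta ?M"
      using M1(1,2) M2(1,2) M3(1,2) by (simp_all add: maj_def)
    ultimately show ?thesis
      by (intro exI[of _ ?M] conjI)
  qed
qed

text \<open>Injects the identity, which realizes any true equation, at position \<open>n\<close> of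
  \<open>Suc m\<close> disjuncts. The last disjunct of \<open>Disjs\<close> is not wrapped, so
  \<open>m\<close> counts the binary disjunctions.\<close>

fun inj_Disjs :: "nat \<Rightarrow> nat \<Rightarrow> trm" where
  "inj_Disjs 0 n = Lam (Var 0)"
| "inj_Disjs (Suc m) 0 = Lam (Lam (App (Var 1) (Lam (Var 0))))"
| "inj_Disjs (Suc m) (Suc n) = Lam (Lam (App (Var 0) (inj_Disjs m n)))"

lemma wf_inj_Disjs: "wf_trm 0 (inj_Disjs m n)"
  by (induction m n rule: inj_Disjs.induct) auto

lemma no_cont_inj_Disjs: "no_cont_no_beta (inj_Disjs m n)"
  by (induction m n rule: inj_Disjs.induct) auto

lemma inj_Disjs_truth:
  assumes "pole P" "n \<le> length As" "Lam (Var 0) \<in> truth P ((A # As) ! n)"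
  shows "inj_Disjs (length As) n \<in> truth P (Disjs (A # As))"
  using assms(2,3)
proof (induction As arbitrary: A n)
  case (Cons B As)
  then show ?case
    using assms(1) by (cases n) (auto intro: DisjI1[simplified] DisjI2)
qed simp

text \<open>Pigeonhole: together \<open>x\<close> and \<open>y\<close> send five indices to only
  four pairs of values.\<close>

lemma two_colourings_pair:
  fixes x y :: "nat \<Rightarrow> nat"
  assumes "\<And>i. x i \<le> 1" "\<And>i. y i \<le> 1"
  shows "\<exists>(i, j)\<in>set pairs. x i = x j \<and> y i = y j"
proof -
  let ?I = "{1, 2, 3, 4, 5} :: nat set" and ?f = "\<lambda>i. (x i, y i)"
  have "?f ` ?I \<subseteq> {..1} \<times> {..1}"
    using assms by auto
  then have "card (?f ` ?I) \<le> card ({..1::nat} \<times> {..1::nat})"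
    by (intro card_mono) auto
  then have "card (?f ` ?I) < card ?I"
    by (simp add: card_cartesian_product del: image_insert)
  then have "\<not> inj_on ?f ?I"
    by (rule pigeonhole)
  then show ?thesis
    unfolding set_pairs inj_on_def by blast
qed

lemma POR_imp_gimel2_le_4:
  "\<exists>t. proof_like t \<and> (\<forall>P. pole P \<longrightarrow> t \<in> truth P (POR \<rightarrow>\<^sub>f gimel2_le_4))"
proof -
  define l where "l = inj_Disjs (length pairs - 1)"
  define E where "E x = {n. n < length pairs \<and> x (fst (pairs ! n)) = x (snd (pairs ! n))}"
    for x :: "nat \<Rightarrow> nat"
  \<comment> \<open>The term cannot see the colouring \<open>x\<close>, so it must succeed for every
    set in this family.\<close>
  define \<F> where "\<F> = E ` {x. \<forall>i. x i \<le> 1}"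
  have "pairs \<noteq> []"
    using set_pairs by (auto simp: pairs_def)
  have "\<F> \<subseteq> Pow {..<length pairs}"
    by (auto simp: \<F>_def E_def)
  then have "finite \<F>"
    by (rule finite_subset) simp
  moreover have "A \<inter> B \<noteq> {}" if AB: "A \<in> \<F>" "B \<in> \<F>" for A B
  proof -
    obtain x y where xy: "A = E x" "B = E y" "\<And>i. x i \<le> 1" "\<And>i. y i \<le> 1"
      using AB by (auto simp: \<F>_def)
    obtain i j where "(i, j) \<in> set pairs" and ij: "x i = x j" "y i = y j"
      using two_colourings_pair[of x y] xy(3,4) by auto
    then obtain n where "n < length pairs" "pairs ! n = (i, j)"
      by (meson in_set_conv_nth)
    with ij have "n \<in> A \<inter> B"
      by (simp add: xy(1,2) E_def)
    then show ?thesis by blast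
  qed
  ultimately obtain M where M: "wf_trm 2 M" "no_cont_no_beta M"
    and bot: "\<And>P p k A. A \<in> \<F> \<Longrightarrow> pole P \<Longrightarrow> p \<in> truth P POR \<Longrightarrow> wf_trm 0 k \<Longrightarrow>
      \<forall>n\<in>A. App k (l n) \<in> orth P stacks \<Longrightarrow> subst_trm (subst_trm M 1 p) 0 k \<in> orth P stacks"
    using maj_term_exists[of l \<F>] wf_inj_Disjs no_cont_inj_Disjs unfolding l_def by blast
  \<comment> \<open>\<open>cc\<close> hands \<open>M\<close> the continuation \<open>k\<close> of
    the disjunction. \<open>App k (l n)\<close> answers with disjunct \<open>n\<close> and discards
    its own stack, so it is in \<open>orth P stacks\<close> when that disjunct is true.\<close>
  let ?t = "Lam (App CC (Lam M))"
  have wf: "wf_trm 0 ?t"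
    using M(1) by (simp add: numeral_2_eq_2)
  have "?t \<in> truth P (POR \<rightarrow>\<^sub>f gimel2_le_4)" if P: "pole P" for P
    unfolding truth_def
  proof (rule orthI[OF wf])
    fix \<rho> assume "\<rho> \<in> falsity P (POR \<rightarrow>\<^sub>f gimel2_le_4)"
    then obtain p \<pi> x where \<rho>: "\<rho> = p \<cdot> \<pi>" and p: "p \<in> truth P POR" and x: "\<And>i. x i \<le> 1"
      and \<pi>: "\<pi> \<in> falsity P (eqs (\<lambda>i. Num (x i)))"
      by (auto simp: truth_def falsity_gimel2_le_4)
    have p0: "wf_trm 0 p"
      using p by (auto simp: truth_def dest: orth_wf)
    have \<pi>0: "wf_stack \<pi>"
      using \<pi> falsity_subset_stacks[OF wf_params_eqs] by (auto simp: stacks_def)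
    let ?k = "Cont \<pi>"
    have "App ?k (l n) \<in> orth P stacks" if n: "n \<in> E x" for n
    proof (rule orthI)
      show "wf_trm 0 (App ?k (l n))"
        using \<pi>0 wf_inj_Disjs by (simp add: l_def)
      fix \<sigma> assume "\<sigma> \<in> stacks"
      obtain q qs where q: "pairs = q # qs"
        using \<open>pairs \<noteq> []\<close> by (cases pairs) auto
      let ?f = "\<lambda>p. Eq (Num (x (fst p))) (Num (x (snd p)))"
      have "(?f q # map ?f qs) ! n = ?f (pairs ! n)"
        using nth_map[of n pairs ?f] n by (simp add: E_def q)
      then have "Lam (Var 0) \<in> truth P ((?f q # map ?f qs) ! n)"
        using n Id_realizes_Eq[OF P] by (simp add: E_def)
      then have "inj_Disjs (length (map ?f qs)) n \<in> truth P (Disjs (?f q # map ?f qs))"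
        using n by (intro inj_Disjs_truth[OF P]) (auto simp: E_def q)
      then have "l n \<in> truth P (eqs (\<lambda>i. Num (x i)))"
        by (simp add: l_def eqs_def q)
      then have "(l n, \<pi>) \<in> P"
        using \<pi> by (auto simp: truth_def dest: orthD)
      then show "(App ?k (l n), \<sigma>) \<in> P"
        using P \<open>\<sigma> \<in> stacks\<close> by (auto simp: stacks_def intro!: pole_App pole_Cont)
    qed
    then have "subst_trm (subst_trm M 1 p) 0 ?k \<in> orth P stacks"
      using x p P \<pi>0 by (intro bot[of "E x"]) (auto simp: \<F>_def)
    then have "(subst_trm (subst_trm M 1 p) 0 ?k, \<pi>) \<in> P"
      using \<pi>0 by (auto simp: stacks_def dest: orthD)
    then show "(?t, \<rho>) \<in> P"
      using P M(1) p0 \<pi>0 unfolding \<rho>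
      by (auto simp: numeral_2_eq_2 intro!: pole_Lam pole_App pole_CC wf_subst_trm)
  qed
  moreover have "proof_like ?t"
    using wf M(2) by (simp add: proof_like_def terms_def)
  ultimately show ?thesis by blast
qed


section \<open>From \<open>|\<gimel>\<^sub>2| \<le> 4\<close> to \<open>POR\<close>\<close>

text \<open>\<open>elim_Disjs vs\<close> expects \<open>d\<close>, \<open>a\<close>, \<open>b\<close>, \<open>c\<close> and eliminates the disjunction of equations \<open>d\<close>, sending its
  \<open>n\<close>-th disjunct to \<open>c\<close>, \<open>b\<close> or \<open>a\<close> when \<open>vs ! n\<close> is 0, 1 or 2 (their de Bruijn indices).\<close>

fun elim_Disjs :: "nat list \<Rightarrow> trm" where
  "elim_Disjs [] = Lam (Var 0)"
| "elim_Disjs [v] = Lam (Lam (Lam (Lam (App (Var 3) (Var v)))))"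
| "elim_Disjs (v # w # vs) = Lam (Lam (Lam (Lam
    (App (App (Var 3) (Lam (App (Var 0) (Var (Suc v)))))
      (Lam (App (App (App (App (elim_Disjs (w # vs)) (Var 0)) (Var 3)) (Var 2)) (Var 1)))))))"

lemma wf_elim_Disjs: "\<forall>v\<in>set vs. v < 3 \<Longrightarrow> wf_trm 0 (elim_Disjs vs)"
  by (induction vs rule: elim_Disjs.induct) auto

lemma no_cont_elim_Disjs: "no_cont_no_beta (elim_Disjs vs)"
  by (induction vs rule: elim_Disjs.induct) auto

text \<open>An equation between distinct numbers eliminates into any closed term, so the selected
  term must be good only for pairs that \<open>x\<close> identifies, whichever disjunct
  \<open>d\<close> uses.\<close>

lemma elim_Disjs:
  assumes "pole P" "S \<subseteq> stacks" "wf_trm 0 a" "wf_trm 0 b" "wf_trm 0 c"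
    and "ps \<noteq> []" "d \<in> truth P (Disjs (map (\<lambda>p. Eq (Num (x (fst p))) (Num (x (snd p)))) ps))"
    and "\<forall>p\<in>set ps. sel p < 3 \<and> (x (fst p) = x (snd p) \<longrightarrow> [c, b, a] ! sel p \<in> orth P S)"
    and "\<pi> \<in> S"
  shows "(elim_Disjs (map sel ps), d \<cdot> a \<cdot> b \<cdot> c \<cdot> \<pi>) \<in> P"
  using assms(6-9)
proof (induction ps arbitrary: d \<pi> rule: list_nonempty_induct)
  case (single p)
  have d: "wf_trm 0 d"
    using single by (auto simp: truth_def dest: orth_wf)
  have "App d ([c, b, a] ! sel p) \<in> orth P S"
    using single assms(1-5)
    by (intro Eq_elim[of P d "x (fst p)" "x (snd p)"]) (auto simp: numeral_3_eq_3 less_Suc_eq)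
  then have "(App d ([c, b, a] ! sel p), \<pi>) \<in> P"
    using single by (auto dest: orthD)
  then show ?case
    using single assms(1-5) d by (auto simp: numeral_3_eq_3 less_Suc_eq intro!: pole_Lam4)
next
  case (cons p ps)
  obtain q qs where q: "ps = q # qs"
    using cons by (cases ps) auto
  let ?f = "\<lambda>p. Eq (Num (x (fst p))) (Num (x (snd p)))"
  let ?c = "[c, b, a] ! sel p"
  let ?D = "elim_Disjs (map sel ps)"
  \<comment> \<open>\<open>?k\<close> and \<open>?r\<close> are the two branches in the body of
    \<open>elim_Disjs\<close> once its four arguments have been substituted.\<close>
  let ?k = "Lam (App (Var 0) ?c)"
  let ?r = "Lam (App (App (App (App ?D (Var 0)) a) b) c)"
  have d: "wf_trm 0 d"
    using cons.prems by (auto simp: truth_def dest: orth_wf)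
  have c: "wf_trm 0 ?c"
    using cons.prems assms(3-5) by (auto simp: numeral_3_eq_3 less_Suc_eq)
  have D: "wf_trm 0 ?D"
    using cons.prems by (intro wf_elim_Disjs) auto
  have "App (App d ?k) ?r \<in> orth P S"
  proof (rule Disj_elim[OF assms(1) _ assms(2)])
    show "d \<in> truth P (Disj (?f p) (Disjs (map ?f ps)))"
      using cons.prems(1) by (simp add: q)
    show "wf_trm 0 ?k" "wf_trm 0 ?r"
      using assms(3-5) c D by auto
  next
    fix t \<pi> assume t: "t \<in> truth P (?f p)" and \<pi>: "\<pi> \<in> S"
    have "App t ?c \<in> orth P S"
      using Eq_elim[OF assms(1) t assms(2) c] cons.prems by simp
    then show "(?k, t \<cdot> \<pi>) \<in> P"
      using assms(1) t c \<pi> by (intro pole_Lam) (auto simp: truth_def dest: orth_wf orthD)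
  next
    fix t \<pi> assume t: "t \<in> truth P (Disjs (map ?f ps))" and \<pi>: "\<pi> \<in> S"
    then have "(?D, t \<cdot> a \<cdot> b \<cdot> c \<cdot> \<pi>) \<in> P"
      using cons.IH cons.prems by simp
    moreover have "wf_trm 0 t"
      using t by (auto simp: truth_def dest: orth_wf)
    ultimately show "(?r, t \<cdot> \<pi>) \<in> P"
      using assms(1,3-5) D by (intro pole_Lam) (auto intro!: pole_App)
  qed
  then have "(App (App d ?k) ?r, \<pi>) \<in> P"
    using cons.prems by (auto dest: orthD)
  then show ?case
    using cons.prems(2) assms(1,3-5) d D
    by (auto simp: q numeral_3_eq_3 less_Suc_eq numeral_2_eq_2 intro!: pole_Lam4)
qed

text \<open>The three conjuncts of \<open>POR\<close> are three cases, in each of which two of the terms \<open>U t u\<close>, \<open>V t u\<close>, \<open>u\<close>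
  are realizers: \<open>A\<close> (first and third), \<open>B\<close> (last two) and \<open>C\<close> (first two). The vertices
  \<open>(vtxA i, vtxB i, vtxC i)\<close> of the cube are pairwise distinct for \<open>i = 1, \<dots>, 5\<close>, so the disjunct of
  a pair \<open>(i, j)\<close> can be false in one of the cases, and then it is answered by the term that is a
  realizer in the two others.\<close>

definition vtxA :: "nat \<Rightarrow> nat" where "vtxA i = of_bool (i \<in> {1, 5})"
definition vtxB :: "nat \<Rightarrow> nat" where "vtxB i = of_bool (i \<in> {2, 5})"
definition vtxC :: "nat \<Rightarrow> nat" where "vtxC i = of_bool (i \<in> {3, 5})"

definition choice :: "nat \<times> nat \<Rightarrow> nat" where
  "choice p = (if vtxC (fst p) \<noteq> vtxC (snd p) then 0 else if vtxA (fst p) \<noteq> vtxA (snd p) then 1 else 2)"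

lemma choice_lt_3: "choice p < 3"
  by (simp add: choice_def)

text \<open>Distinct vertices that agree in the coordinates \<open>vtxC\<close> and
  \<open>vtxA\<close> must differ in the remaining one.\<close>

lemma choice_2: "p \<in> set pairs \<Longrightarrow> choice p = 2 \<Longrightarrow> vtxB (fst p) \<noteq> vtxB (snd p)"
  by (auto simp: pairs_def choice_def vtxA_def vtxB_def vtxC_def split: if_splits)

lemma gimel2_le_4_imp_POR:
  "\<exists>t. proof_like t \<and> (\<forall>P. pole P \<longrightarrow> t \<in> truth P (gimel2_le_4 \<rightarrow>\<^sub>f POR))"
proof -
  let ?D = "elim_Disjs (map choice pairs)"
  let ?Vtu = "App (App (Var 2) (Var 1)) (Var 0)"
  let ?Utu = "App (App (Var 3) (Var 1)) (Var 0)"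
  \<comment> \<open>Indices 4 down to 0 are the realizer of \<open>gimel2_le_4\<close>, then
    \<open>U\<close>, \<open>V\<close>, \<open>t\<close> and \<open>u\<close>.\<close>
  let ?t = "Lam (Lam (Lam (Lam (Lam (App (App (App (App ?D (Var 4)) ?Utu) ?Vtu) (Var 0))))))"
  have D: "wf_trm 0 ?D"
    by (rule wf_elim_Disjs) (auto simp: choice_lt_3)
  have wf: "wf_trm 0 ?t"
    using D by simp
  have "pairs \<noteq> []"
    by (auto simp: pairs_def)
  have "?t \<in> truth P (gimel2_le_4 \<rightarrow>\<^sub>f POR)" if P: "pole P" for P
    unfolding truth_def
  proof (rule orthI[OF wf])
    fix \<sigma> assume "\<sigma> \<in> falsity P (gimel2_le_4 \<rightarrow>\<^sub>f POR)"
    then obtain d \<rho> where \<sigma>: "\<sigma> = d \<cdot> \<rho>" "d \<in> truth P gimel2_le_4" "\<rho> \<in> falsity P POR"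
      by (auto simp: truth_def)
    then obtain U V \<rho>' where \<rho>: "\<rho> = U \<cdot> V \<cdot> \<rho>'" "wf_trm 0 U" "wf_trm 0 V" and cases:
      "U \<in> truth P (BoolF (Num 1)) \<and> \<rho>' \<in> falsity P (BoolF (Num 1)) \<or>
       V \<in> truth P (BoolF (Num 1)) \<and> \<rho>' \<in> falsity P (BoolF (Num 1)) \<or>
       U \<in> truth P (BoolF (Num 0)) \<and> V \<in> truth P (BoolF (Num 0)) \<and> \<rho>' \<in> falsity P (BoolF (Num 0))"
      unfolding falsity_POR by blast
    obtain b where \<rho>'_Bool: "\<rho>' \<in> falsity P (BoolF (Num b))"
      and b: "U \<in> truth P (BoolF (Num b)) \<and> b = 1 \<or> V \<in> truth P (BoolF (Num b)) \<and> b = 1 \<or>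
        U \<in> truth P (BoolF (Num b)) \<and> V \<in> truth P (BoolF (Num b))"
      using cases by metis
    obtain S t u \<pi> where \<rho>': "\<rho>' = t \<cdot> u \<cdot> \<pi>" and S: "S \<subseteq> stacks" "\<pi> \<in> S"
      and tu: "wf_trm 0 t" "wf_trm 0 u" "b = 0 \<longrightarrow> t \<in> orth P S" "b = 1 \<longrightarrow> u \<in> orth P S"
      using \<rho>'_Bool unfolding falsity_BoolF by blast
    let ?a = "App (App U t) u" and ?b = "App (App V t) u"
    have a: "?a \<in> orth P S" if "U \<in> truth P (BoolF (Num b))"
      using P that S(1) tu by (intro BoolF_elim) auto
    have b': "?b \<in> orth P S" if "V \<in> truth P (BoolF (Num b))"
      using P that S(1) tu by (intro BoolF_elim) auto
    have d: "d \<in> truth P (eqs (\<lambda>i. Num (x i)))" if "\<forall>i. x i \<le> 1" for x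
      using \<sigma>(2) that unfolding truth_def by (auto simp: falsity_gimel2_le_4 elim!: orth_mono)
    \<comment> \<open>The realizer is the same in all cases; only the instance \<open>x\<close> of
      the five variables, invisible to terms, depends on the case.\<close>
    have "\<exists>x::nat \<Rightarrow> nat. (\<forall>i. x i \<le> 1) \<and>
      (\<forall>p\<in>set pairs. x (fst p) = x (snd p) \<longrightarrow> [u, ?b, ?a] ! choice p \<in> orth P S)"
      using b
    proof (elim disjE conjE)
      assume "U \<in> truth P (BoolF (Num b))" "b = 1"
      then show ?thesis
        using a tu by (intro exI[of _ vtxA]) (auto simp: choice_def vtxA_def)
    next
      assume "V \<in> truth P (BoolF (Num b))" "b = 1"
      then show ?thesis
        using b' tu choice_2 by (intro exI[of _ vtxB]) (auto simp: choice_def vtxB_def)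
    next
      assume "U \<in> truth P (BoolF (Num b))" "V \<in> truth P (BoolF (Num b))"
      then show ?thesis
        using a b' by (intro exI[of _ vtxC]) (auto simp: choice_def vtxC_def)
    qed
    then obtain x :: "nat \<Rightarrow> nat" where x: "\<forall>i. x i \<le> 1"
      "\<forall>p\<in>set pairs. x (fst p) = x (snd p) \<longrightarrow> [u, ?b, ?a] ! choice p \<in> orth P S"
      by blast
    have "(?D, d \<cdot> ?a \<cdot> ?b \<cdot> u \<cdot> \<pi>) \<in> P"
      by (rule elim_Disjs[OF P S(1) _ _ _ \<open>pairs \<noteq> []\<close>, where x = x])
        (use \<rho> tu S x d[OF x(1)] choice_lt_3 in \<open>auto simp: eqs_def\<close>)
    moreover have "wf_trm 0 d"
      using \<sigma>(2) by (auto simp: truth_def dest: orth_wf)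
    ultimately show "(?t, \<sigma>) \<in> P"
      using P D \<rho> tu unfolding \<sigma>(1) \<rho>(1) \<rho>'
      by (intro pole_Lam5) (auto intro!: pole_App)
  qed
  moreover have "proof_like ?t"
    using wf no_cont_elim_Disjs by (simp add: proof_like_def terms_def)
  ultimately show ?thesis by blast
qed

section \<open>Pairing the two implications\<close>

lemma realizes_Iff:
  assumes "pole P" "t \<in> truth P (A \<rightarrow>\<^sub>f B)" "u \<in> truth P (B \<rightarrow>\<^sub>f A)"
  shows "realizes P (Lam (App (App (Var 0) t) u)) (Iff A B)"
  unfolding realizes_def truth_def Iff_def
proof (rule orthI)
  have wf: "wf_trm 0 t" "wf_trm 0 u"
    using assms(2,3) by (auto simp: truth_def dest: orth_wf)
  then show "wf_trm 0 (Lam (App (App (Var 0) t) u))"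
    by simp
  fix \<rho> assume "\<rho> \<in> falsity P (Conj (A \<rightarrow>\<^sub>f B) (B \<rightarrow>\<^sub>f A))"
  then obtain S f \<pi> where \<rho>: "\<rho> = f \<cdot> \<pi>" "\<pi> \<in> S"
    and f: "f \<in> orth P {t \<cdot> u \<cdot> \<pi> |t u \<pi>. t \<in> truth P (A \<rightarrow>\<^sub>f B) \<and> u \<in> truth P (B \<rightarrow>\<^sub>f A) \<and> \<pi> \<in> S}"
    unfolding falsity_Conj by blast
  have "(f, t \<cdot> u \<cdot> \<pi>) \<in> P"
    using orthD[OF f] assms(2,3) \<rho>(2) by blast
  then show "(Lam (App (App (Var 0) t) u), \<rho>) \<in> P"
    using assms(1) wf orth_wf[OF f] unfolding \<rho>(1) by (intro pole_Lam) (auto intro!: pole_App)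
qed

theorem mainTheorem2:
  shows "universally_equivalent POR gimel2_le_4"
proof -
  obtain t where t: "proof_like t" "\<forall>P. pole P \<longrightarrow> t \<in> truth P (POR \<rightarrow>\<^sub>f gimel2_le_4)"
    using POR_imp_gimel2_le_4 by blast
  obtain u where u: "proof_like u" "\<forall>P. pole P \<longrightarrow> u \<in> truth P (gimel2_le_4 \<rightarrow>\<^sub>f POR)"
    using gimel2_le_4_imp_POR by blast
  have "proof_like (Lam (App (App (Var 0) t) u))"
    using t(1) u(1) by (simp add: proof_like_def terms_def)
  then show ?thesis
    unfolding universally_equivalent_def
    using closed_POR closed_gimel2_le_4 realizes_Iff t(2) u(2) by blast
qed

end
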